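(* For a subset $A$ of the real line $\mathbb R$ (with its usual metric) the following conditions are equivalent: (1) $A$ has zero length in $\mathbb R$; (2) the closure $\bar A$ is compact and has zero length in $\mathbb R$; (3) the closure $\bar A$ is compact and has $1$-dimensional Hausdorff measure zero; (4) the closure $\bar A$ is compact and has Lebesgue measure zero.
   Context: A graph is a pair $\Gamma=(V,E)$ of a (possibly infinite) set $V$ of vertices and a set $E$ of edges, each edge being a nonempty subset of $V$ of cardinality at most $2$. A subset $C\subseteq V$ is connected if any $x,y\in C$ are joined by a sequence $c_0=x,\dots,c_n=y$ in $C$ with $\{c_{i-1},c_i\}\in E$ for $1\le i\le n$; maximal connected subsets of $V$ are the connected components of $\Gamma$. A graph in a metric space $(X,d_X)$ is a graph with $V\subseteq X$; its total length is $\ell(\Gamma)=\sum_{\{x,y\}\in E}d_X(x,y)\in[0,\infty]$ (supremum of finite subsums if $E$ is infinite). A set $A\subseteq X$ has zero length in $X$ if for every $\varepsilon>0$ there is a graph $\Gamma=(V,E)$ in $X$ with finitely many connected components such that $A\subseteq\overline V$ (closure in $X$) and $\ell(\Gamma)<\varepsilon$. A subset $A$ of a metric space $X$ has $1$-dimensional Hausdorff measure zero if for every $\varepsilon>0$ there exist a countable set $C\subseteq X$ and a function $\epsilon:C\to(0,1]$ such that $\sum_{c\in C}\epsilon(c)<\varepsilon$ and $A\subseteq\bigcup_{c\in C}B(c,\epsilon(c))$, where $B(x,\delta)=\{y\in X:d_X(x,y)<\delta\}$. *)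

theory Defs
  imports "HOL-Analysis.Analysis"
begin

definition is_graph :: "'a set \<Rightarrow> 'a set set \<Rightarrow> bool" where
  "is_graph V E \<longleftrightarrow> (\<forall>e\<in>E. e \<subseteq> V \<and> e \<noteq> {} \<and> finite e \<and> card e \<le> 2)"

definition graph_connected :: "'a set set \<Rightarrow> 'a set \<Rightarrow> bool" where
  "graph_connected E C \<longleftrightarrow>
     (\<forall>x\<in>C. \<forall>y\<in>C. \<exists>(c :: nat \<Rightarrow> 'a) n.
        c 0 = x \<and> c n = y \<and> (\<forall>i\<le>n. c i \<in> C) \<and> (\<forall>i\<in>{1..n}. {c (i - 1), c i} \<in> E))"

definition graph_components :: "'a set \<Rightarrow> 'a set set \<Rightarrow> 'a set set" where
  "graph_components V E =
     {C. C \<subseteq> V \<and> graph_connected E C \<and>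
         (\<forall>D. D \<subseteq> V \<and> graph_connected E D \<and> C \<subseteq> D \<longrightarrow> D = C)}"

text \<open>The metric space \<open>X\<close> is the whole carrier of a type of class \<open>metric_space\<close>,
  so the condition \<open>V \<subseteq> X\<close> is automatic. An edge \<open>{x, y}\<close>, possibly with \<open>x = y\<close>,
  has length \<open>dist x y\<close>; this does not depend on the order of \<open>x\<close> and \<open>y\<close>.\<close>

definition edge_length :: "'a::metric_space set \<Rightarrow> real" where
  "edge_length e = (THE l. \<exists>x y. e = {x, y} \<and> l = dist x y)"

lemma edge_length_doubleton [simp]: "edge_length {x, y} = dist x y"
  unfolding edge_length_def
  by (rule the_equality) (auto simp: doubleton_eq_iff dist_commute)

text \<open>The sum is taken in \<open>ennreal\<close>, where every family is summable.\<close>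

definition graph_length :: "'a::metric_space set set \<Rightarrow> ennreal" where
  "graph_length E = (\<Sum>\<^sub>\<infinity>e\<in>E. ennreal (edge_length e))"

lemma graph_length_eq_SUP:
  "graph_length E = (SUP F\<in>{F. finite F \<and> F \<subseteq> E}. \<Sum>e\<in>F. ennreal (edge_length e))"
  unfolding graph_length_def by (rule nonneg_infsum_complete) simp

definition zero_length :: "'a::metric_space set \<Rightarrow> bool" where
  "zero_length A \<longleftrightarrow>
     (\<forall>\<epsilon>::real. \<epsilon> > 0 \<longrightarrow>
        (\<exists>V E. is_graph V E \<and> finite (graph_components V E) \<and>
               A \<subseteq> closure V \<and> graph_length E < ennreal \<epsilon>))"

definition hausdorff1_null :: "'a::metric_space set \<Rightarrow> bool" where
  "hausdorff1_null A \<longleftrightarrow>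
     (\<forall>\<epsilon>::real. \<epsilon> > 0 \<longrightarrow>
        (\<exists>(C :: 'a set) (r :: 'a \<Rightarrow> real).
           countable C \<and> (\<forall>c\<in>C. 0 < r c \<and> r c \<le> 1) \<and>
           (\<Sum>\<^sub>\<infinity>c\<in>C. ennreal (r c)) < ennreal \<epsilon> \<and> A \<subseteq> (\<Union>c\<in>C. ball c (r c))))"

end

theory Submission
  imports Defs
begin

text \<open>
  Let \<open>K\<close> be the closure of \<open>A\<close>. A graph witnesses zero length of \<open>A\<close> exactly when it
  witnesses zero length of \<open>K\<close>, so the theorem says that zero length of \<open>A\<close> forces \<open>K\<close> to be a
  compact null set, that a compact null set has both zero length and Hausdorff measure zero, and
  that a compact set of Hausdorff measure zero is null. The last point is finite subadditivity of
  Lebesgue measure, applied to a finite subcover by balls.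

  Zero length implies compact and null (\<open>zero_length_closure_compact_null\<close>): a path in a graph
  on the line sweeps out the whole interval between its ends, so the distance of its ends is at
  most the total length of the edges that it visits. Each component therefore lies in a compact
  interval no longer than the edges inside it. The components are finitely many and share no edge,
  so all vertices lie in one compact set of measure at most the length of the graph, and this set
  contains the closure of the vertices.

  The converse directions use the dyadic cells of width \<open>2^(-m)\<close> that meet \<open>K\<close>. As \<open>K\<close> is compact
  and null, a small open neighbourhood of \<open>K\<close> contains all of them as soon as \<open>m\<close> is large, so
  their total width tends to \<open>0\<close> (\<open>dyadic_cells_small\<close>). Balls around their left ends give
  Hausdorff measure zero. For zero length (\<open>compact_null_imp_zero_length\<close>), choose levels
  \<open>p 0 < p 1 < \<dots>\<close> at which the total widths decrease geometrically, and cut every cell of level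
  \<open>p n\<close> that meets \<open>K\<close> into edges of length \<open>2^(-p (n + 1))\<close>. The edges of step \<open>n\<close> are then no
  longer in total than the cells of level \<open>p n\<close>, however fine the next level is, and they link
  each cell of level \<open>p (n + 1)\<close> that meets \<open>K\<close> to the cell of level \<open>p n\<close> around it. So every
  vertex is joined to one of the finitely many cells of level \<open>p 0\<close>, and the vertices
  accumulate at every point of \<open>K\<close>.
\<close>

section \<open>Connected components of a graph\<close>

definition links :: "'a set set \<Rightarrow> ('a \<times> 'a) set" where
  "links E = {(x, y). {x, y} \<in> E}"

lemma links_rtrancl_sym: "(x, y) \<in> (links E)\<^sup>* \<Longrightarrow> (y, x) \<in> (links E)\<^sup>*"
proof -
  have "sym (links E)"
    by (auto simp: links_def sym_def insert_commute)
  then show "(x, y) \<in> (links E)\<^sup>* \<Longrightarrow> (y, x) \<in> (links E)\<^sup>*"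
    by (metis sym_rtrancl symD)
qed

lemma graph_connected_links:
  assumes "graph_connected E C" "x \<in> C" "y \<in> C"
  shows "(x, y) \<in> (links E)\<^sup>*"
proof -
  obtain c and n :: nat where c: "c 0 = x" "c n = y" "\<forall>i\<in>{1..n}. {c (i - 1), c i} \<in> E"
    using assms unfolding graph_connected_def by blast
  have "(c i, c (Suc i)) \<in> links E" if "i < n" for i
    using c(3)[rule_format, of "Suc i"] that by (auto simp: links_def)
  then show ?thesis
    using c(1,2) relpow_fun_conv[of x y n "links E"] by (auto simp: rtrancl_is_UN_relpow)
qed

lemma reach_class_connected: "graph_connected E ((links E)\<^sup>* `` {x})"
  unfolding graph_connected_def
proof (intro ballI)
  fix u v assume uv: "u \<in> (links E)\<^sup>* `` {x}" "v \<in> (links E)\<^sup>* `` {x}"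
  then have "(u, v) \<in> (links E)\<^sup>*"
    by (meson Image_singleton_iff links_rtrancl_sym rtrancl_trans)
  then obtain n c where c: "c 0 = u" "c n = v" "\<forall>i<n. (c i, c (Suc i)) \<in> links E"
    by (auto simp: rtrancl_is_UN_relpow relpow_fun_conv)
  have "c i \<in> (links E)\<^sup>* `` {x}" if "i \<le> n" for i
    using that
  proof (induction i)
    case 0
    then show ?case using uv c by simp
  next
    case (Suc i)
    then show ?case
      using c(3)[rule_format, of i] by (auto intro: rtrancl_into_rtrancl)
  qed
  moreover have "{c (i - 1), c i} \<in> E" if "i \<in> {1..n}" for i
    using c(3)[rule_format, of "i - 1"] that by (auto simp: links_def)
  ultimately show "\<exists>c (n :: nat). c 0 = u \<and> c n = v \<and> (\<forall>i\<le>n. c i \<in> (links E)\<^sup>* `` {x}) \<and>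
      (\<forall>i\<in>{1..n}. {c (i - 1), c i} \<in> E)"
    using c(1,2) by blast
qed

lemma reach_class_subset:
  assumes "is_graph V E" "x \<in> V"
  shows "(links E)\<^sup>* `` {x} \<subseteq> V"
proof
  fix y assume "y \<in> (links E)\<^sup>* `` {x}"
  then have "(x, y) \<in> (links E)\<^sup>*" by simp
  then show "y \<in> V"
    by induction (use assms in \<open>auto simp: is_graph_def links_def\<close>)
qed

text \<open>
  Together with the next lemma this identifies the nonempty components with the classes of mutual
  reachability; hence every vertex lies in a component and distinct components are disjoint.
\<close>

lemma reach_class_component:
  assumes "is_graph V E" "x \<in> V"
  shows "(links E)\<^sup>* `` {x} \<in> graph_components V E"
  unfolding graph_components_def
proof (intro CollectI conjI allI impI)
  show "(links E)\<^sup>* `` {x} \<subseteq> V" by (rule reach_class_subset[OF assms])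
  show "graph_connected E ((links E)\<^sup>* `` {x})" by (rule reach_class_connected)
  fix D assume D: "D \<subseteq> V \<and> graph_connected E D \<and> (links E)\<^sup>* `` {x} \<subseteq> D"
  then have "D \<subseteq> (links E)\<^sup>* `` {x}"
    using graph_connected_links[of E D x] by auto
  with D show "D = (links E)\<^sup>* `` {x}" by blast
qed

lemma component_eq_reach_class:
  assumes "is_graph V E" "C \<in> graph_components V E" "x \<in> C"
  shows "C = (links E)\<^sup>* `` {x}"
proof -
  have C: "C \<subseteq> V" "graph_connected E C"
    and max: "\<And>D. D \<subseteq> V \<Longrightarrow> graph_connected E D \<Longrightarrow> C \<subseteq> D \<Longrightarrow> D = C"
    using assms(2) by (auto simp: graph_components_def)
  have "C \<subseteq> (links E)\<^sup>* `` {x}"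
    using graph_connected_links[OF C(2) assms(3)] by auto
  then show ?thesis
    using max[OF reach_class_subset[OF assms(1)] reach_class_connected] C(1) assms(3) by blast
qed

lemma finite_components_if_roots:
  assumes "is_graph V E" "finite R" "\<And>x. x \<in> V \<Longrightarrow> \<exists>r\<in>R. (r, x) \<in> (links E)\<^sup>*"
  shows "finite (graph_components V E)"
proof (rule finite_subset)
  \<comment> \<open>The empty set is a component of the empty graph.\<close>
  show "graph_components V E \<subseteq> insert {} ((\<lambda>r. (links E)\<^sup>* `` {r}) ` R)"
  proof
    fix C assume C: "C \<in> graph_components V E"
    show "C \<in> insert {} ((\<lambda>r. (links E)\<^sup>* `` {r}) ` R)"
    proof (cases "C = {}")
      case False
      then obtain x where x: "x \<in> C" by blast
      then have "x \<in> V" using C by (auto simp: graph_components_def)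
      then obtain r where r: "r \<in> R" "(r, x) \<in> (links E)\<^sup>*" using assms(3) by blast
      have "C = (links E)\<^sup>* `` {x}"
        by (rule component_eq_reach_class[OF assms(1) C x])
      also have "\<dots> = (links E)\<^sup>* `` {r}"
        using r(2) links_rtrancl_sym[OF r(2)] by (auto intro: rtrancl_trans)
      finally show ?thesis using r(1) by blast
    qed simp
  qed
qed (use assms(2) in simp)

section \<open>Zero length implies bounded with null closure\<close>

text \<open>
  A discrete intermediate value theorem: a walk on the line that jumps along its edges cannot get
  from one end to the other without some edge passing over each point in between.
\<close>

lemma closed_segment_subset_path:
  fixes c :: "nat \<Rightarrow> real"
  assumes "0 < n"
  shows "closed_segment (c 0) (c n) \<subseteq> (\<Union>i<n. closed_segment (c i) (c (Suc i)))"
  using assms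
proof (induction n rule: nat_induct_non_zero)
  case 1
  then show ?case by auto
next
  case (Suc n)
  have "closed_segment (c 0) (c (Suc n)) \<subseteq>
      closed_segment (c 0) (c n) \<union> closed_segment (c n) (c (Suc n))"
    by (auto simp: closed_segment_eq_real_ivl split: if_splits)
  with Suc.IH show ?case by (auto simp: lessThan_Suc)
qed

lemma emeasure_closed_segment:
  fixes x y :: real
  shows "emeasure lborel (closed_segment x y) = ennreal (dist x y)"
  by (auto simp: closed_segment_eq_real_ivl dist_real_def)

text \<open>
  A path may use an edge repeatedly, whereas the length of the graph counts it once. Measuring the
  union of the segments spanned by the \<^emph>\<open>set\<close> of visited edges avoids reducing the path
  to one without repetitions.
\<close>

lemma dist_le_component_length:
  fixes C :: "real set"
  assumes "graph_connected E C" "x \<in> C" "y \<in> C"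
  shows "ennreal (dist x y) \<le> graph_length {e\<in>E. e \<subseteq> C}"
proof -
  obtain c and n :: nat where c: "c 0 = x" "c n = y" "\<forall>i\<le>n. c i \<in> C"
      "\<forall>i\<in>{1..n}. {c (i - 1), c i} \<in> E"
    using assms unfolding graph_connected_def by blast
  define F where "F = (\<lambda>i. {c i, c (Suc i)}) ` {..<n}"
  have F: "finite F" "F \<subseteq> {e\<in>E. e \<subseteq> C}"
    using c(3) c(4)[rule_format, of "Suc i" for i] by (auto simp: F_def)
  show ?thesis
  proof (cases "n = 0")
    case True
    then show ?thesis using c by simp
  next
    case False
    have "ennreal (dist x y) = emeasure lborel (closed_segment (c 0) (c n))"
      by (simp add: emeasure_closed_segment c)
    also have "\<dots> \<le> emeasure lborel (\<Union>e\<in>F. convex hull e)"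
    proof (rule emeasure_mono)
      show "closed_segment (c 0) (c n) \<subseteq> (\<Union>e\<in>F. convex hull e)"
        using closed_segment_subset_path[of n c] False
        by (auto simp: F_def segment_convex_hull)
      have "compact (\<Union>e\<in>F. convex hull e)"
        using F(1) by (intro compact_UN) (auto simp: F_def simp flip: segment_convex_hull)
      then show "(\<Union>e\<in>F. convex hull e) \<in> sets lborel"
        by (simp add: borel_compact)
    qed
    also have "\<dots> \<le> (\<Sum>e\<in>F. emeasure lborel (convex hull e))"
      using F(1) by (intro emeasure_subadditive_finite)
        (auto simp: F_def simp flip: segment_convex_hull)
    also have "\<dots> = (\<Sum>e\<in>F. ennreal (edge_length e))"
      by (intro sum.cong) (auto simp: F_def emeasure_closed_segment simp flip: segment_convex_hull)
    also have "\<dots> \<le> graph_length {e\<in>E. e \<subseteq> C}"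
      unfolding graph_length_eq_SUP using F by (intro SUP_upper) auto
    finally show ?thesis .
  qed
qed

lemma component_subset_interval:
  fixes C :: "real set"
  assumes "graph_connected E C" "graph_length E < \<infinity>"
  shows "\<exists>a b. C \<subseteq> {a..b} \<and> emeasure lborel {a..b} \<le> graph_length {e\<in>E. e \<subseteq> C}"
proof (cases "C = {}")
  case True
  \<comment> \<open>An empty interval is used, since \<open>Inf\<close> and \<open>Sup\<close> of the empty set carry no information.\<close>
  then show ?thesis by (intro exI[of _ 1] exI[of _ 0]) simp
next
  case False
  have "graph_length {e\<in>E. e \<subseteq> C} \<le> graph_length E"
    unfolding graph_length_eq_SUP by (intro SUP_subset_mono) auto
  with assms(2) have "graph_length {e\<in>E. e \<subseteq> C} < top" by (simp add: less_top)
  then obtain l where l: "graph_length {e\<in>E. e \<subseteq> C} = ennreal l" "0 \<le> l"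
    by (cases "graph_length {e\<in>E. e \<subseteq> C}") auto
  have d: "dist x y \<le> l" if "x \<in> C" "y \<in> C" for x y
    using dist_le_component_length[OF assms(1) that] l by simp
  have bdd: "bounded C"
    using False d unfolding bounded_def by blast
  have "C \<subseteq> {Inf C..Sup C}"
    using bdd by (auto intro!: cInf_lower cSup_upper bounded_imp_bdd_below bounded_imp_bdd_above)
  moreover have "Sup C - Inf C \<le> l"
  proof -
    have "Sup C \<le> l + Inf C"
    proof (rule cSup_least[OF False])
      fix x assume x: "x \<in> C"
      have "x - l \<le> Inf C"
        by (rule cInf_greatest[OF False]) (use d[OF x] in \<open>force simp: dist_real_def abs_le_iff\<close>)
      then show "x \<le> l + Inf C" by simp
    qed
    then show ?thesis by simp
  qed
  moreover have "Inf C \<le> Sup C"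
    using False bdd by (meson bounded_imp_bdd_above bounded_imp_bdd_below cInf_le_cSup)
  ultimately show ?thesis
    by (intro exI[of _ "Inf C"] exI[of _ "Sup C"]) (auto simp: l intro: ennreal_leI)
qed

text \<open>
  The bounds for the single components add up to the length of the whole graph because an edge is
  nonempty and so lies inside at most one component.
\<close>

lemma vertices_subset_compact:
  fixes V :: "real set"
  assumes "is_graph V E" "finite (graph_components V E)" "graph_length E < \<infinity>"
  shows "\<exists>S. compact S \<and> V \<subseteq> S \<and> emeasure lborel S \<le> graph_length E"
proof -
  let ?K = "graph_components V E"
  let ?E = "\<lambda>C. {e\<in>E. e \<subseteq> C}"
  have "\<forall>C\<in>?K. \<exists>a b. C \<subseteq> {a..b} \<and> emeasure lborel {a..b} \<le> graph_length (?E C)"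
    using component_subset_interval assms(3) by (auto simp: graph_components_def)
  then obtain a b where ab: "\<And>C. C \<in> ?K \<Longrightarrow> C \<subseteq> {a C..b C}"
      "\<And>C. C \<in> ?K \<Longrightarrow> emeasure lborel {a C..b C} \<le> graph_length (?E C)"
    by metis
  define S where "S = (\<Union>C\<in>?K. {a C..b C})"
  have "compact S"
    unfolding S_def using assms(2) by (intro compact_UN) auto
  moreover have "V \<subseteq> S"
  proof
    fix x assume "x \<in> V"
    then have "(links E)\<^sup>* `` {x} \<in> ?K" by (rule reach_class_component[OF assms(1)])
    then show "x \<in> S" using ab(1) unfolding S_def by blast
  qed
  moreover have "emeasure lborel S \<le> graph_length E"
  proof -
    have "emeasure lborel S \<le> (\<Sum>C\<in>?K. emeasure lborel {a C..b C})"
      unfolding S_def using assms(2) by (intro emeasure_subadditive_finite) auto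
    also have "\<dots> \<le> (\<Sum>C\<in>?K. graph_length (?E C))"
      by (intro sum_mono ab)
    also have "\<dots> = graph_length (\<Union>C\<in>?K. ?E C)"
      unfolding graph_length_def
    proof (rule sum_infsum[OF assms(2)])
      fix C D assume CD: "C \<in> ?K" "D \<in> ?K" "C \<noteq> D"
      have False if e: "e \<in> E" "e \<subseteq> C" "e \<subseteq> D" for e
      proof -
        obtain x where "x \<in> C" "x \<in> D"
          using e assms(1) unfolding is_graph_def by blast
        then show False
          using component_eq_reach_class[OF assms(1) CD(1)]
            component_eq_reach_class[OF assms(1) CD(2)] CD(3) by metis
      qed
      then show "?E C \<inter> ?E D = {}" by blast
    qed (auto intro: nonneg_summable_on_complete)
    also have "\<dots> \<le> graph_length E"
      unfolding graph_length_eq_SUP by (intro SUP_subset_mono) auto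
    finally show ?thesis .
  qed
  ultimately show ?thesis by blast
qed

lemma zero_length_closure: "zero_length (closure A) \<longleftrightarrow> zero_length A"
proof -
  have "closure A \<subseteq> closure V \<longleftrightarrow> A \<subseteq> closure V" for V
    by (metis closed_closure closure_minimal closure_subset subset_trans)
  then show ?thesis by (simp add: zero_length_def)
qed

lemma zero_length_closure_compact_null:
  fixes A :: "real set"
  assumes "zero_length A"
  shows "compact (closure A) \<and> closure A \<in> null_sets lborel"
proof -
  have cover: "\<exists>S. compact S \<and> closure A \<subseteq> S \<and> emeasure lborel S \<le> ennreal \<epsilon>" if \<epsilon>: "\<epsilon> > 0" for \<epsilon>
  proof -
    obtain V E where G: "is_graph V E" "finite (graph_components V E)"
      "A \<subseteq> closure V" "graph_length E < ennreal \<epsilon>"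
      using assms \<epsilon> unfolding zero_length_def by blast
    have "graph_length E < \<infinity>" using G(4) less_trans[OF _ ennreal_less_top] by simp
    then obtain S where S: "compact S" "V \<subseteq> S" "emeasure lborel S \<le> graph_length E"
      using vertices_subset_compact[OF G(1,2)] by blast
    have "closure V \<subseteq> S" using S by (simp add: closure_minimal compact_imp_closed)
    then have "closure A \<subseteq> S" using G(3) S(1) by (meson closure_minimal compact_imp_closed order_trans)
    then show ?thesis using S(1,3) G(4) by (meson less_imp_le order_trans)
  qed
  obtain S where "compact S" "closure A \<subseteq> S" using cover[of 1] by auto
  then have comp: "compact (closure A)"
    by (meson bounded_subset closed_closure compact_eq_bounded_closed)
  have "emeasure lborel (closure A) \<le> ennreal \<epsilon>" if \<epsilon>: "\<epsilon> > 0" for \<epsilon>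
  proof -
    obtain S where S: "compact S" "closure A \<subseteq> S" "emeasure lborel S \<le> ennreal \<epsilon>"
      using cover[OF \<epsilon>] by blast
    have "emeasure lborel (closure A) \<le> emeasure lborel S"
      using S(1,2) by (intro emeasure_mono) (simp_all add: borel_compact)
    then show ?thesis using S(3) by (rule order_trans)
  qed
  then have "emeasure lborel (closure A) \<le> 0 + ennreal \<epsilon>" if "\<epsilon> > 0" for \<epsilon>
    using that by (simp only: add_0)
  then have "emeasure lborel (closure A) \<le> 0" by (rule ennreal_le_epsilon)
  then show ?thesis using comp by (auto simp: null_sets_def)
qed

section \<open>Dyadic cells of a compact null set\<close>

text \<open>
  The cell \<open>[j / 2^m, (j + 1) / 2^m)\<close> is represented by its index \<open>j\<close>; the cells are half-open so
  that those of one level are disjoint and each point lies in exactly one.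
\<close>

definition dyadic_cells :: "real set \<Rightarrow> nat \<Rightarrow> int set" where
  "dyadic_cells K m = (\<lambda>x. \<lfloor>x * 2 ^ m\<rfloor>) ` K"

lemma finite_dyadic_cells:
  assumes "bounded K"
  shows "finite (dyadic_cells K m)"
proof -
  obtain B where B: "\<forall>x\<in>K. \<bar>x\<bar> \<le> B" using assms by (auto simp: bounded_real)
  have "\<lfloor>- B * 2 ^ m\<rfloor> \<le> \<lfloor>x * 2 ^ m\<rfloor> \<and> \<lfloor>x * 2 ^ m\<rfloor> \<le> \<lfloor>B * 2 ^ m\<rfloor>" if "x \<in> K" for x
  proof -
    have "- B \<le> x" "x \<le> B" using B that by (auto simp: abs_le_iff)
    then show ?thesis by (intro conjI floor_mono mult_right_mono) auto
  qed
  then have "dyadic_cells K m \<subseteq> {\<lfloor>- B * 2 ^ m\<rfloor>..\<lfloor>B * 2 ^ m\<rfloor>}"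
    by (auto simp: dyadic_cells_def)
  then show ?thesis by (rule finite_subset) simp
qed

lemma dyadic_floor_dist:
  fixes x :: real
  shows "dist x (of_int \<lfloor>x * 2 ^ m\<rfloor> / 2 ^ m) < 1 / 2 ^ m"
proof -
  have "of_int \<lfloor>x * 2 ^ m\<rfloor> / 2 ^ m \<le> x" "x < (of_int \<lfloor>x * 2 ^ m\<rfloor> + 1) / 2 ^ m"
    by (simp_all add: divide_le_eq less_divide_eq)
  then show ?thesis by (simp add: dist_real_def add_divide_distrib abs_less_iff)
qed

text \<open>The coarse cell around a fine cell that meets \<open>K\<close> meets \<open>K\<close> at the same point.\<close>

lemma dyadic_cells_parent:
  assumes "m \<le> q" "i \<in> dyadic_cells K q"
  shows "i div 2 ^ (q - m) \<in> dyadic_cells K m"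
proof -
  obtain x where x: "x \<in> K" "i = \<lfloor>x * 2 ^ q\<rfloor>" using assms(2) by (auto simp: dyadic_cells_def)
  have "x * 2 ^ m = x * 2 ^ q / real (2 ^ (q - m))"
    using assms(1) by (simp add: field_simps flip: power_add)
  then have "\<lfloor>x * 2 ^ m\<rfloor> = i div 2 ^ (q - m)"
    using floor_divide_real_eq_div[of "2 ^ (q - m)" "x * 2 ^ q"] x(2) by simp
  then show ?thesis using x(1) unfolding dyadic_cells_def by (metis imageI)
qed

text \<open>
  An open \<open>U\<close> of measure below \<open>\<epsilon>\<close> contains \<open>K\<close>, and by compactness a whole \<open>\<delta>\<close>-neighbourhood of
  \<open>K\<close>. Cells narrower than \<open>\<delta>\<close> that meet \<open>K\<close> lie in \<open>U\<close>, and they are disjoint, so their total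
  width is at most the measure of \<open>U\<close>. Compactness is essential: a null set that is dense in an interval
  meets every cell there.
\<close>

lemma dyadic_cells_small:
  assumes "compact K" "K \<in> null_sets lborel" "\<epsilon> > 0"
  shows "\<forall>\<^sub>F m in sequentially. card (dyadic_cells K m) / 2 ^ m < \<epsilon>"
proof -
  have "K \<in> sets borel" using assms(1) by (simp add: borel_compact)
  then obtain U where U: "open U" "K \<subseteq> U" "emeasure lborel (U - K) < \<epsilon>"
    using outer_regular_lborel assms(3) by blast
  have eU: "emeasure lborel U < ennreal \<epsilon>"
    using U(1,3) emeasure_Diff_null_set[OF assms(2), of U] by (simp add: borel_open)
  obtain \<delta> where \<delta>: "\<delta> > 0" "(\<Union>x\<in>K. ball x \<delta>) \<subseteq> U"
    using compact_subset_open_imp_ball_epsilon_subset[OF assms(1) U(1,2)] .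
  have "(\<lambda>m. (1/2) ^ m :: real) \<longlonglongrightarrow> 0" by (rule LIMSEQ_realpow_zero) auto
  then have "\<forall>\<^sub>F m in sequentially. (1/2) ^ m < \<delta>"
    using \<delta>(1) by (simp add: order_tendstoD)
  then show ?thesis
  proof (rule eventually_mono)
    fix m assume m: "(1/2) ^ m < \<delta>"
    let ?J = "dyadic_cells K m"
    let ?I = "\<lambda>j. {of_int j / 2 ^ m ..< (of_int j + 1) / 2 ^ m :: real}"
    have fin: "finite ?J" using assms(1) by (simp add: compact_imp_bounded finite_dyadic_cells)
    have mem: "\<lfloor>z * 2 ^ m\<rfloor> = j" if "z \<in> ?I j" for z j
      using that by (intro floor_unique) (auto simp: field_simps)
    have "ennreal (card ?J / 2 ^ m) = (\<Sum>j\<in>?J. emeasure lborel (?I j))"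
      by (simp add: divide_right_mono add_divide_distrib ennreal_of_nat_eq_real_of_nat flip: ennreal_mult)
    also have "\<dots> = emeasure lborel (\<Union>j\<in>?J. ?I j)"
    proof (rule sum_emeasure)
      show "disjoint_family_on ?I ?J"
        unfolding disjoint_family_on_def using mem by blast
    qed (use fin in auto)
    also have "\<dots> \<le> emeasure lborel U"
    proof (rule emeasure_mono)
      show "(\<Union>j\<in>?J. ?I j) \<subseteq> U"
      proof
        fix z assume "z \<in> (\<Union>j\<in>?J. ?I j)"
        then obtain x where x: "x \<in> K" "z \<in> ?I \<lfloor>x * 2 ^ m\<rfloor>"
          unfolding dyadic_cells_def by blast
        have "x \<in> ?I \<lfloor>x * 2 ^ m\<rfloor>"
          by (simp add: divide_le_eq less_divide_eq)
        then have "dist x z < 1 / 2 ^ m"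
          using x(2) by (auto simp: dist_real_def abs_less_iff add_divide_distrib)
        then have "z \<in> ball x \<delta>" using m by (simp add: power_divide)
        then show "z \<in> U" using \<delta>(2) x(1) by blast
      qed
    qed (use U in simp)
    also note eU
    finally show "card ?J / 2 ^ m < \<epsilon>" using assms(3) by (simp add: ennreal_less_iff)
  qed
qed

section \<open>Hausdorff measure\<close>

lemma compact_null_imp_hausdorff1_null:
  fixes K :: "real set"
  assumes "compact K" "K \<in> null_sets lborel"
  shows "hausdorff1_null K"
  unfolding hausdorff1_null_def
proof (intro allI impI)
  fix \<epsilon> :: real assume "\<epsilon> > 0"
  then obtain m where m: "card (dyadic_cells K m) / 2 ^ m < \<epsilon>"
    using eventually_happens'[OF sequentially_bot dyadic_cells_small[OF assms]] by blast
  have fin: "finite (dyadic_cells K m)"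
    using assms(1) by (simp add: compact_imp_bounded finite_dyadic_cells)
  define C where "C = (\<lambda>j. of_int j / 2 ^ m :: real) ` dyadic_cells K m"
  have finC: "finite C" using fin by (simp add: C_def)
  have "(\<Sum>\<^sub>\<infinity>c\<in>C. ennreal (1 / 2 ^ m)) = ennreal (card C / 2 ^ m)"
    using finC by (simp add: ennreal_of_nat_eq_real_of_nat flip: ennreal_mult)
  also have "\<dots> \<le> ennreal (card (dyadic_cells K m) / 2 ^ m)"
    unfolding C_def using card_image_le[OF fin] by (intro ennreal_leI divide_right_mono) auto
  also have "\<dots> < ennreal \<epsilon>" using m \<open>\<epsilon> > 0\<close> by (simp add: ennreal_lessI)
  finally have "(\<Sum>\<^sub>\<infinity>c\<in>C. ennreal (1 / 2 ^ m)) < ennreal \<epsilon>" .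
  moreover have "K \<subseteq> (\<Union>c\<in>C. ball c (1 / 2 ^ m))"
    using dyadic_floor_dist[of _ m] by (fastforce simp: C_def dyadic_cells_def dist_commute)
  ultimately show "\<exists>C r. countable C \<and> (\<forall>c\<in>C. 0 < r c \<and> r c \<le> 1) \<and>
      (\<Sum>\<^sub>\<infinity>c\<in>C. ennreal (r c)) < ennreal \<epsilon> \<and> K \<subseteq> (\<Union>c\<in>C. ball c (r c))"
    using finC by (intro exI[of _ C] exI[of _ "\<lambda>_. 1 / 2 ^ m"]) (auto simp: countable_finite)
qed

text \<open>
  By compactness finitely many of the balls suffice, so finite subadditivity bounds the measure of
  \<open>K\<close>. A ball of radius \<open>r c\<close> has measure \<open>2 * r c\<close>, which is why the cover is taken for
  \<open>\<epsilon> / 2\<close>.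
\<close>

lemma hausdorff1_null_compact_imp_null:
  fixes K :: "real set"
  assumes "compact K" "hausdorff1_null K"
  shows "K \<in> null_sets lborel"
proof -
  have "emeasure lborel K \<le> 0 + ennreal \<epsilon>" if "\<epsilon> > 0" for \<epsilon>
  proof -
    obtain C and r :: "real \<Rightarrow> real" where C: "\<forall>c\<in>C. 0 < r c \<and> r c \<le> 1"
      "(\<Sum>\<^sub>\<infinity>c\<in>C. ennreal (r c)) < ennreal (\<epsilon> / 2)" "K \<subseteq> (\<Union>c\<in>C. ball c (r c))"
      using assms(2)[unfolded hausdorff1_null_def, rule_format, of "\<epsilon> / 2"] \<open>\<epsilon> > 0\<close> by auto
    obtain D where D: "D \<subseteq> C" "finite D" "K \<subseteq> (\<Union>c\<in>D. ball c (r c))"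
      using compactE_image[OF assms(1) _ C(3)] by (metis open_ball)
    have "emeasure lborel K \<le> emeasure lborel (\<Union>c\<in>D. ball c (r c))"
      using D(3) by (intro emeasure_mono) (auto intro!: borel_open)
    also have "\<dots> \<le> (\<Sum>c\<in>D. emeasure lborel (ball c (r c)))"
      using D(2) by (intro emeasure_subadditive_finite) auto
    also have "\<dots> = (\<Sum>c\<in>D. 2 * ennreal (r c))"
    proof (rule sum.cong)
      fix c assume "c \<in> D"
      then have "0 < r c" using C(1) D(1) by blast
      then show "emeasure lborel (ball c (r c)) = 2 * ennreal (r c)"
        by (simp add: ball_eq_greaterThanLessThan ennreal_mult' flip: mult_2)
    qed simp
    also have "\<dots> = 2 * (\<Sum>c\<in>D. ennreal (r c))"
      by (rule sum_distrib_left[symmetric])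
    also have "(\<Sum>c\<in>D. ennreal (r c)) \<le> (\<Sum>\<^sub>\<infinity>c\<in>C. ennreal (r c))"
      using D(1,2) by (subst nonneg_infsum_complete) (auto intro: SUP_upper)
    also have "2 * (\<Sum>\<^sub>\<infinity>c\<in>C. ennreal (r c)) \<le> 2 * ennreal (\<epsilon> / 2)"
      using C(2) by (intro mult_left_mono) auto
    also have "2 * ennreal (\<epsilon> / 2) = ennreal \<epsilon>"
      using \<open>\<epsilon> > 0\<close> ennreal_mult'[of 2 "\<epsilon> / 2"] by simp
    finally show ?thesis by (simp add: mult_left_mono)
  qed
  then have "emeasure lborel K \<le> 0" by (rule ennreal_le_epsilon)
  then show ?thesis using assms(1) by (auto simp: null_sets_def borel_compact)
qed

section \<open>A short graph that is dense in a compact null set\<close>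

definition grid_edge :: "nat \<Rightarrow> int \<Rightarrow> real set" where
  "grid_edge q i = {of_int i / 2 ^ q, (of_int i + 1) / 2 ^ q}"

text \<open>
  For \<open>m \<le> q\<close> the grid edge with index \<open>i\<close> of level \<open>q\<close> lies in the closed cell with index
  \<open>i div 2^(q - m)\<close> of level \<open>m\<close>; all grid edges in cells of level \<open>m\<close> that meet \<open>K\<close> are taken,
  including those that are far from \<open>K\<close> and only serve to connect the others.
\<close>

definition cell_subdivision :: "real set \<Rightarrow> nat \<Rightarrow> nat \<Rightarrow> real set set" where
  "cell_subdivision K m q = grid_edge q ` {i. i div 2 ^ (q - m) \<in> dyadic_cells K m}"

lemma edge_length_grid_edge: "edge_length (grid_edge q i) = 1 / 2 ^ q"
  by (simp add: grid_edge_def dist_real_def add_divide_distrib)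

text \<open>
  Each cell is cut into \<open>2^(q - m)\<close> edges of length \<open>2^(-q)\<close>, so the bound depends on the coarse
  level \<open>m\<close> alone. This leaves \<open>q\<close> free to be chosen as large as the next step needs.
\<close>

lemma cell_subdivision_length:
  assumes "bounded K" "m \<le> q"
  shows "finite (cell_subdivision K m q) \<and>
    (\<Sum>e\<in>cell_subdivision K m q. edge_length e) \<le> card (dyadic_cells K m) / 2 ^ m"
proof -
  let ?J = "dyadic_cells K m"
  let ?d = "2 ^ (q - m) :: int"
  let ?I = "{i. i div ?d \<in> ?J}"
  have finJ: "finite ?J" by (rule finite_dyadic_cells[OF assms(1)])
  have I: "?I \<subseteq> (\<Union>j\<in>?J. {j * ?d..<j * ?d + ?d})" (is "_ \<subseteq> ?U")
  proof
    fix i assume i: "i \<in> ?I"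
    have "i div ?d * ?d \<le> i" "i < i div ?d * ?d + ?d"
    proof -
      have "0 \<le> i mod ?d" "i mod ?d < ?d" by simp_all
      then show "i div ?d * ?d \<le> i" "i < i div ?d * ?d + ?d"
        using div_mult_mod_eq[of i ?d] by linarith+
    qed
    then show "i \<in> ?U" using i by (intro UN_I[of "i div ?d"]) auto
  qed
  have finI: "finite ?I" by (rule finite_subset[OF I]) (use finJ in simp)
  have "card ?I \<le> card ?U" by (rule card_mono[OF _ I]) (use finJ in simp)
  also have "\<dots> \<le> (\<Sum>j\<in>?J. card {j * ?d..<j * ?d + ?d})" by (rule card_UN_le[OF finJ])
  also have "\<dots> = card ?J * 2 ^ (q - m)" by (simp add: nat_power_eq)
  finally have cI: "real (card ?I) \<le> card ?J * 2 ^ (q - m)"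
    by (metis of_nat_le_iff of_nat_mult of_nat_numeral of_nat_power)
  have "(\<Sum>e\<in>cell_subdivision K m q. edge_length e) \<le> (\<Sum>i\<in>?I. (edge_length \<circ> grid_edge q) i)"
    unfolding cell_subdivision_def
    by (rule sum_image_le[OF finI]) (simp add: edge_length_grid_edge)
  also have "\<dots> = card ?I / 2 ^ q" by (simp add: edge_length_grid_edge)
  also have "\<dots> \<le> card ?J * 2 ^ (q - m) / 2 ^ q" using cI by (rule divide_right_mono) simp
  also have "\<dots> = card ?J / 2 ^ m"
    using assms(2) by (simp add: field_simps flip: power_add)
  finally show ?thesis using finI by (simp add: cell_subdivision_def)
qed

text \<open>The left end of a coarse cell reaches every grid point of the cell by steps to the right.\<close>

lemma grid_walk:
  fixes j :: int
  assumes "\<And>i. i div 2 ^ k = j \<Longrightarrow> grid_edge q i \<in> E" "i div 2 ^ k = j"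
  shows "(of_int (j * 2 ^ k) / 2 ^ q, of_int i / 2 ^ q) \<in> (links E)\<^sup>*"
proof -
  let ?d = "2 ^ k :: int"
  have walk: "n < ?d \<Longrightarrow> (of_int (j * ?d) / 2 ^ q, of_int (j * ?d + int n) / 2 ^ q) \<in> (links E)\<^sup>*" for n
  proof (induction n)
    case 0
    then show ?case by simp
  next
    case (Suc n)
    have "int n div ?d = 0" using Suc.prems by (intro div_pos_pos_trivial) linarith+
    then have "(j * ?d + int n) div ?d = j" by (simp add: mult.commute)
    then have "(of_int (j * ?d + int n) / 2 ^ q, of_int (j * ?d + int (Suc n)) / 2 ^ q) \<in> links E"
      using assms(1)[of "j * ?d + int n"] by (simp add: links_def grid_edge_def add_ac)
    moreover have "int n < ?d" using Suc.prems by linarith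
    ultimately show ?case by (meson Suc.IH rtrancl_into_rtrancl)
  qed
  have "i = j * ?d + int (nat (i mod ?d))"
    using assms(2) div_mult_mod_eq[of i ?d] by simp
  moreover have "int (nat (i mod ?d)) < ?d" by simp
  ultimately show ?thesis using walk by metis
qed

lemma cell_subdivision_grid_walk:
  assumes "m \<le> q" "cell_subdivision K m q \<subseteq> E" "i div 2 ^ (q - m) = j" "j \<in> dyadic_cells K m"
  shows "(of_int j / 2 ^ m, of_int i / 2 ^ q) \<in> (links E)\<^sup>*"
proof -
  have "of_int (j * 2 ^ (q - m)) / 2 ^ q = (of_int j / 2 ^ m :: real)"
    using assms(1) by (simp add: field_simps flip: power_add)
  moreover have "(of_int (j * 2 ^ (q - m)) / 2 ^ q, of_int i / 2 ^ q) \<in> (links E)\<^sup>*"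
    by (rule grid_walk) (use assms in \<open>auto simp: cell_subdivision_def\<close>)
  ultimately show ?thesis by simp
qed

lemma sum_UN_le_sum:
  fixes f :: "'a \<Rightarrow> real"
  assumes "finite I" "\<And>i. i \<in> I \<Longrightarrow> finite (A i)" "\<And>i x. i \<in> I \<Longrightarrow> x \<in> A i \<Longrightarrow> 0 \<le> f x"
  shows "sum f (\<Union>i\<in>I. A i) \<le> (\<Sum>i\<in>I. sum f (A i))"
proof -
  have "sum f (snd ` Sigma I A) \<le> sum (f \<circ> snd) (Sigma I A)"
    using assms by (intro sum_image_le) auto
  also have "sum (f \<circ> snd) (Sigma I A) = (\<Sum>i\<in>I. sum f (A i))"
    using assms by (subst sum.Sigma) (auto simp: case_prod_unfold)
  finally show ?thesis by (simp add: snd_image_Sigma)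
qed

text \<open>
  No finite graph works when \<open>K\<close> is infinite, since its vertices would already contain \<open>K\<close>. The
  graph is built step by step: connecting two levels costs only the total width of the coarser
  one, and these widths form a convergent series with a small sum.
\<close>

lemma compact_null_imp_zero_length:
  fixes K :: "real set"
  assumes "compact K" "K \<in> null_sets lborel"
  shows "zero_length K"
  unfolding zero_length_def
proof (intro allI impI)
  fix \<epsilon> :: real assume "\<epsilon> > 0"
  have bdd: "bounded K" using assms(1) by (rule compact_imp_bounded)
  \<comment> \<open>The bounds \<open>\<epsilon> / 4 * (1/2)^n\<close> sum to \<open>\<epsilon> / 2\<close>, which keeps the length strictly below \<open>\<epsilon>\<close>.\<close>
  let ?P = "\<lambda>n m. card (dyadic_cells K m) / 2 ^ m < \<epsilon> / 4 * (1/2) ^ n"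
  have ev: "\<forall>\<^sub>F m in sequentially. ?P n m" for n
    using dyadic_cells_small[OF assms, of "\<epsilon> / 4 * (1/2) ^ n"] \<open>\<epsilon> > 0\<close> by simp
  have step: "\<exists>m'. ?P n m' \<and> m < m'" for n m
    using eventually_happens'[OF sequentially_bot
        eventually_conj[OF ev[of n] eventually_gt_at_top[of m]]] .
  obtain p where p: "\<And>n. ?P n (p n)" "\<And>n. p n < p (Suc n)"
    using dependent_nat_choice[of ?P "\<lambda>_ m m'. m < m'"] step by metis
  have p_ge: "n \<le> p n" for n
    using p(2) by (simp add: strict_mono_Suc_iff strict_mono_imp_increasing)
  define E where "E = (\<Union>n. cell_subdivision K (p n) (p (Suc n)))"
  define V where "V = \<Union>E"
  have graph: "is_graph V E"
    unfolding is_graph_def V_def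
    by (auto simp: E_def cell_subdivision_def grid_edge_def card_insert_if)

  have "graph_length E \<le> ennreal (\<epsilon> / 2)"
    unfolding graph_length_eq_SUP
  proof (rule SUP_least)
    fix F assume "F \<in> {F. finite F \<and> F \<subseteq> E}"
    then have F: "finite F" "F \<subseteq> E" by auto
    have "\<exists>N. F \<subseteq> (\<Union>n<N. cell_subdivision K (p n) (p (Suc n)))"
      using F
    proof (induction F)
      case (insert e F)
      then obtain N where "F \<subseteq> (\<Union>n<N. cell_subdivision K (p n) (p (Suc n)))" by auto
      moreover obtain n where "e \<in> cell_subdivision K (p n) (p (Suc n))"
        using insert.prems by (auto simp: E_def)
      ultimately show ?case
        by (intro exI[of _ "max N (Suc n)"]) (fastforce simp: less_max_iff_disj)
    qed simp
    then obtain N where N: "F \<subseteq> (\<Union>n<N. cell_subdivision K (p n) (p (Suc n)))" by blast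
    have fin: "finite (cell_subdivision K (p n) (p (Suc n)))"
      and len: "(\<Sum>e\<in>cell_subdivision K (p n) (p (Suc n)). edge_length e)
        \<le> card (dyadic_cells K (p n)) / 2 ^ p n" for n
      using cell_subdivision_length[OF bdd less_imp_le[OF p(2)]] by auto
    have nonneg: "0 \<le> edge_length e" if "e \<in> E" for e
      using that by (auto simp: E_def cell_subdivision_def edge_length_grid_edge)
    have "(\<Sum>e\<in>F. edge_length e) \<le> (\<Sum>e\<in>(\<Union>n<N. cell_subdivision K (p n) (p (Suc n))). edge_length e)"
      using N fin nonneg by (intro sum_mono2) (auto simp: E_def)
    also have "\<dots> \<le> (\<Sum>n<N. \<Sum>e\<in>cell_subdivision K (p n) (p (Suc n)). edge_length e)"
      using fin nonneg by (intro sum_UN_le_sum) (auto simp: E_def)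
    also have "\<dots> \<le> (\<Sum>n<N. \<epsilon> / 4 * (1/2) ^ n)"
      using len p(1) by (intro sum_mono) (meson less_imp_le order_trans)
    also have "\<dots> = \<epsilon> / 4 * (\<Sum>n<N. (1/2) ^ n)" by (simp add: sum_distrib_left)
    also have "\<dots> \<le> \<epsilon> / 4 * 2"
    proof (rule mult_left_mono)
      have "(\<Sum>n<N. (1/2) ^ n) = 2 - 2 * (1/2 :: real) ^ N"
        by (induction N) auto
      then show "(\<Sum>n<N. (1/2 :: real) ^ n) \<le> 2" by simp
    qed (use \<open>\<epsilon> > 0\<close> in simp)
    finally have "(\<Sum>e\<in>F. edge_length e) \<le> \<epsilon> / 2" by simp
    then show "(\<Sum>e\<in>F. ennreal (edge_length e)) \<le> ennreal (\<epsilon> / 2)"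
      using F(2) nonneg by (subst sum_ennreal) (auto intro: ennreal_leI)
  qed
  also have "\<dots> < ennreal \<epsilon>" using \<open>\<epsilon> > 0\<close> by (simp add: ennreal_lessI)
  finally have length: "graph_length E < ennreal \<epsilon>" .

  have sub: "cell_subdivision K (p n) (p (Suc n)) \<subseteq> E" for n by (auto simp: E_def)
  define R where "R = (\<lambda>j. of_int j / 2 ^ p 0 :: real) ` dyadic_cells K (p 0)"
  \<comment> \<open>Climbing from a cell to the cells around it at coarser levels leads to a root of level \<open>p 0\<close>.\<close>
  have root: "\<exists>r\<in>R. (r, of_int j / 2 ^ p n) \<in> (links E)\<^sup>*" if "j \<in> dyadic_cells K (p n)" for j n
    using that
  proof (induction n arbitrary: j)
    case 0
    then show ?case by (auto simp: R_def)
  next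
    case (Suc n)
    have par: "j div 2 ^ (p (Suc n) - p n) \<in> dyadic_cells K (p n)"
      using dyadic_cells_parent[OF less_imp_le[OF p(2)] Suc.prems] .
    show ?case
      using Suc.IH[OF par] cell_subdivision_grid_walk[OF less_imp_le[OF p(2)] sub refl par]
      by (meson rtrancl_trans)
  qed
  have "\<exists>r\<in>R. (r, x) \<in> (links E)\<^sup>*" if x: "x \<in> V" for x
  proof -
    obtain n i where i: "i div 2 ^ (p (Suc n) - p n) \<in> dyadic_cells K (p n)"
      "x \<in> grid_edge (p (Suc n)) i"
      using x unfolding V_def E_def cell_subdivision_def by blast
    let ?y = "of_int i / 2 ^ p (Suc n) :: real"
    obtain r where r: "r \<in> R" "(r, ?y) \<in> (links E)\<^sup>*"
      using root[OF i(1)] cell_subdivision_grid_walk[OF less_imp_le[OF p(2)] sub refl i(1)]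
      by (meson rtrancl_trans)
    have "grid_edge (p (Suc n)) i \<in> E"
      using i(1) by (auto simp: E_def cell_subdivision_def)
    then have "x = ?y \<or> (?y, x) \<in> links E"
      using i(2) by (auto simp: links_def grid_edge_def)
    then show ?thesis using r by (auto intro: rtrancl_into_rtrancl)
  qed
  moreover have "finite R" using finite_dyadic_cells[OF bdd] by (simp add: R_def)
  ultimately have comps: "finite (graph_components V E)"
    using finite_components_if_roots[OF graph] by blast

  \<comment> \<open>The left end of the cell of level \<open>p (n + 1)\<close> around a point of \<open>K\<close> is a vertex.\<close>
  have "K \<subseteq> closure V"
  proof
    fix x assume x: "x \<in> K"
    show "x \<in> closure V"
      unfolding closure_approachable
    proof (intro allI impI)
      fix e :: real assume "e > 0"
      then obtain n where n: "(1/2) ^ n < e"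
        using real_arch_pow_inv[of e "1/2"] by auto
      let ?q = "p (Suc n)"
      let ?i = "\<lfloor>x * 2 ^ ?q\<rfloor>"
      have "?i div 2 ^ (?q - p n) \<in> dyadic_cells K (p n)"
        using x less_imp_le[OF p(2)] by (intro dyadic_cells_parent) (auto simp: dyadic_cells_def)
      then have "of_int ?i / 2 ^ ?q \<in> V"
        by (auto simp: V_def E_def cell_subdivision_def grid_edge_def)
      moreover have "dist (of_int ?i / 2 ^ ?q) x < e"
      proof -
        have "dist (of_int ?i / 2 ^ ?q) x < (1/2) ^ ?q"
          using dyadic_floor_dist[of x ?q] by (simp add: dist_commute power_divide)
        also have "\<dots> \<le> (1/2) ^ n"
          using p_ge[of "Suc n"] by (intro power_decreasing) auto
        finally show ?thesis using n by simp
      qed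
      ultimately show "\<exists>y\<in>V. dist y x < e" by blast
    qed
  qed
  with graph comps length
  show "\<exists>V E. is_graph V E \<and> finite (graph_components V E) \<and> K \<subseteq> closure V \<and>
      graph_length E < ennreal \<epsilon>"
    by blast
qed

theorem proposition2:
  fixes A :: "real set"
  shows "(zero_length A \<longleftrightarrow> compact (closure A) \<and> zero_length (closure A)) \<and>
         (compact (closure A) \<and> zero_length (closure A) \<longleftrightarrow>
            compact (closure A) \<and> hausdorff1_null (closure A)) \<and>
         (compact (closure A) \<and> hausdorff1_null (closure A) \<longleftrightarrow>
            compact (closure A) \<and> closure A \<in> null_sets lebesgue)"
proof -
  have "closure A \<in> null_sets lebesgue \<longleftrightarrow> closure A \<in> null_sets lborel"
    by (auto simp: null_sets_def)
  then show ?thesis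
    using zero_length_closure[of A] zero_length_closure_compact_null[of A]
      compact_null_imp_zero_length[of "closure A"] compact_null_imp_hausdorff1_null[of "closure A"]
      hausdorff1_null_compact_imp_null[of "closure A"]
    by blast
qed

end
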